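(* Let $\mathfrak{g}$ be a finite-dimensional semi-simple Lie algebra over $\mathbb{C}$. Then there exists a prelie product on $\mathfrak{g}$ inducing its bracket if, and only if, there exists a very good pointed $\mathfrak{g}$-module.
   Context: A (left) prelie product on a vector space $\mathfrak{g}$ is a bilinear product $\star$ such that $(x\star y)\star z-x\star(y\star z)=(y\star x)\star z-y\star(x\star z)$ for all $x,y,z$. It induces the bracket of the Lie algebra $\mathfrak{g}$ if $[x,y]=x\star y-y\star x$ for all $x,y\in\mathfrak{g}$. A pointed $\mathfrak{g}$-module is a couple $(M,m)$ with $M$ a $\mathfrak{g}$-module and $m\in M$. It is very good if the map $\Upsilon_m:\mathfrak{g}\to M$, $x\mapsto x.m$, is bijective. *)

theory Defs
  imports Complex_Main
begin

definition bilinear_map ::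
  "('k::field \<Rightarrow> 'a::ab_group_add \<Rightarrow> 'a) \<Rightarrow> ('k \<Rightarrow> 'b::ab_group_add \<Rightarrow> 'b)
    \<Rightarrow> ('k \<Rightarrow> 'c::ab_group_add \<Rightarrow> 'c) \<Rightarrow> ('a \<Rightarrow> 'b \<Rightarrow> 'c) \<Rightarrow> bool"
  where "bilinear_map s1 s2 s3 f \<longleftrightarrow>
    (\<forall>x. Vector_Spaces.linear s2 s3 (\<lambda>y. f x y)) \<and>
    (\<forall>y. Vector_Spaces.linear s1 s3 (\<lambda>x. f x y))"

locale lie_algebra = vector_space scale
  for scale :: "'k::field \<Rightarrow> 'g::ab_group_add \<Rightarrow> 'g" +
  fixes bracket :: "'g \<Rightarrow> 'g \<Rightarrow> 'g"
  assumes bracket_bilinear: "bilinear_map scale scale scale bracket"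
    and bracket_self: "bracket x x = 0"
    and jacobi: "bracket x (bracket y z) + bracket y (bracket z x) + bracket z (bracket x y) = 0"
begin

definition lie_ideal :: "'g set \<Rightarrow> bool"
  where "lie_ideal I \<longleftrightarrow> subspace I \<and> (\<forall>x. \<forall>y\<in>I. bracket x y \<in> I)"

primrec derived_series :: "'g set \<Rightarrow> nat \<Rightarrow> 'g set"
  where
    "derived_series I 0 = I"
  | "derived_series I (Suc n) =
      span {bracket x y | x y. x \<in> derived_series I n \<and> y \<in> derived_series I n}"

definition solvable :: "'g set \<Rightarrow> bool"
  where "solvable I \<longleftrightarrow> (\<exists>n. derived_series I n = {0})"

text \<open>The radical is zero, i.e. there is no nonzero solvable ideal. The zero algebra is
  semisimple in this convention.\<close>

definition semisimple :: bool
  where "semisimple \<longleftrightarrow> (\<forall>I. lie_ideal I \<and> solvable I \<longrightarrow> I = {0})"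

end

locale lie_module =
  lie_algebra scale bracket + M: vector_space scaleM
  for scale :: "'k::field \<Rightarrow> 'g::ab_group_add \<Rightarrow> 'g"
    and bracket :: "'g \<Rightarrow> 'g \<Rightarrow> 'g"
    and scaleM :: "'k \<Rightarrow> 'm::ab_group_add \<Rightarrow> 'm" +
  fixes act :: "'g \<Rightarrow> 'm \<Rightarrow> 'm"
  assumes act_bilinear: "bilinear_map scale scaleM scaleM act"
    and act_bracket: "act (bracket x y) v = act x (act y v) - act y (act x v)"

text \<open>The module is the whole type of \<open>m\<close>, so a pointed module is just a module together
  with an element \<open>m\<close> of that type.\<close>

definition very_good_pointed_module ::
  "('k::field \<Rightarrow> 'g::ab_group_add \<Rightarrow> 'g) \<Rightarrow> ('g \<Rightarrow> 'g \<Rightarrow> 'g)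
    \<Rightarrow> ('k \<Rightarrow> 'm::ab_group_add \<Rightarrow> 'm) \<Rightarrow> ('g \<Rightarrow> 'm \<Rightarrow> 'm) \<Rightarrow> 'm \<Rightarrow> bool"
  where "very_good_pointed_module scale bracket scaleM act m \<longleftrightarrow>
    lie_module scale bracket scaleM act \<and> bij (\<lambda>x. act x m)"

definition prelie_product ::
  "('k::field \<Rightarrow> 'g::ab_group_add \<Rightarrow> 'g) \<Rightarrow> ('g \<Rightarrow> 'g \<Rightarrow> 'g) \<Rightarrow> bool"
  where "prelie_product scale star \<longleftrightarrow>
    bilinear_map scale scale scale star \<and>
    (\<forall>x y z. star (star x y) z - star x (star y z) = star (star y x) z - star y (star x z))"

definition induces_bracket ::
  "('g::ab_group_add \<Rightarrow> 'g \<Rightarrow> 'g) \<Rightarrow> ('g \<Rightarrow> 'g \<Rightarrow> 'g) \<Rightarrow> bool"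
  where "induces_bracket star bracket \<longleftrightarrow> (\<forall>x y. bracket x y = star x y - star y x)"

end

(* A very good pointed module (M, m) yields the prelie product x * y = Y^-1 (x.(y.m)), Y x = x.m.
   Conversely both sides fail unless g = 0. Given a prelie product, left multiplication L is a
   representation whose kernel is an abelian ideal, hence it is faithful, and by Cartan's criterion
   its trace form is nondegenerate. With dual bases b_i, c_i put w = sum_i b_i * c_i. Invariance of
   sum_i b_i (x) c_i gives x * w = sum_i b_i * (c_i * x), i.e. right multiplication by w is the
   Casimir operator, of trace dim g. But x -> tr R_x = tr L_x - tr (ad x) vanishes on
   brackets and therefore everywhere, so dim g = 0. *)

theory Submission
  imports Defs "HOL-Computational_Algebra.Fundamental_Theorem_Algebra"
begin

section \<open>Generalized eigenspaces and the trace\<close>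

text \<open>The main weight lies in Cartan's criterion. The operator \<open>S\<close> used there
  multiplies each generalized eigenspace of \<open>act x\<close> by the conjugate of its eigenvalue.
  Eigenvalues of \<open>bracket x\<close> and of \<open>act x\<close> add up under the action and
  conjugation is additive, so the commutator of \<open>S\<close> with \<open>act v\<close> is a
  multiple of \<open>act v\<close> when \<open>v\<close> is a generalized eigenvector of
  \<open>bracket x\<close>; this is all that the trace has to see. Conjugation moreover makes the
  trace of \<open>act x\<close> composed with \<open>S\<close> a sum of squared moduli, which
  vanishes only if every eigenvalue does. Engel's theorem is phrased with a filtration of the module
  instead of a common null vector, because for a faithful module the same filtration also yields the
  normalizing element of the inductive step and solvability. Semisimplicity enters through three
  ideals: the kernel of left multiplication, the radical of the trace form, and the center. The last
  one explains why a functional vanishing on brackets is zero: it is the pairing with a vector, and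
  invariance makes that vector central.\<close>

locale linear_algebra = vector_space scale
  for scale :: "'a::field \<Rightarrow> 'b::ab_group_add \<Rightarrow> 'b"
begin

abbreviation endo :: "('b \<Rightarrow> 'b) \<Rightarrow> bool"
  where "endo T \<equiv> Vector_Spaces.linear scale scale T"

definition sub_scalar :: "('b \<Rightarrow> 'b) \<Rightarrow> 'a \<Rightarrow> 'b \<Rightarrow> 'b"
  where "sub_scalar T a v = T v - scale a v"

definition gen_eigenspace :: "('b \<Rightarrow> 'b) \<Rightarrow> 'a \<Rightarrow> 'b set"
  where "gen_eigenspace T a = {v. \<exists>n. (sub_scalar T a ^^ n) v = 0}"

lemma endoI:
  assumes "\<And>x y. T (x + y) = T x + T y" "\<And>c x. T (scale c x) = scale c (T x)"
  shows "endo T"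
  unfolding Vector_Spaces.linear_iff using assms vector_space_axioms by blast

lemma endo_simps:
  assumes "endo T"
  shows "T (x + y) = T x + T y" "T (scale c x) = scale c (T x)" "T 0 = 0"
    "T (x - y) = T x - T y" "T (- x) = - T x"
proof -
  interpret Vector_Spaces.linear scale scale T
    by (fact assms)
  show "T (x + y) = T x + T y" "T (scale c x) = scale c (T x)" "T 0 = 0"
    "T (x - y) = T x - T y" "T (- x) = - T x"
    by (simp_all add: add scale diff neg)
qed

lemma endo_sum: "endo T \<Longrightarrow> T (sum f A) = (\<Sum>a\<in>A. T (f a))"
  by (rule module_hom.sum[where ?s1.0 = scale and ?s2.0 = scale])
    (simp add: module_hom_iff_linear)

lemma endo_scale_sum: "endo T \<Longrightarrow> T (\<Sum>a\<in>A. scale (c a) (f a)) = (\<Sum>a\<in>A. scale (c a) (T (f a)))"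
  by (simp add: endo_sum endo_simps)

lemma endo_compose: "endo S \<Longrightarrow> endo T \<Longrightarrow> endo (\<lambda>v. S (T v))"
  by (rule endoI) (simp_all add: endo_simps)

lemma endo_diff: "endo S \<Longrightarrow> endo T \<Longrightarrow> endo (\<lambda>v. S v - T v)"
  by (rule endoI) (simp_all add: endo_simps scale_right_diff_distrib)

lemma endo_eq_on_span:
  assumes "endo S" "endo T" "\<And>b. b \<in> B \<Longrightarrow> S b = T b" "v \<in> span B"
  shows "S v = T v"
  using assms(4) by (induction rule: span_induct_alt) (simp_all add: assms endo_simps)

lemma endo_sub_scalar: "endo T \<Longrightarrow> endo (sub_scalar T a)"
  by (rule endoI) (simp_all add: sub_scalar_def endo_simps algebra_simps)

lemma endo_funpow: "endo T \<Longrightarrow> endo (T ^^ n)"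
  by (induction n) (auto intro!: endoI simp: endo_simps)

lemma sub_scalar_commute: "endo T \<Longrightarrow> sub_scalar T a (sub_scalar T b v) = sub_scalar T b (sub_scalar T a v)"
  by (simp add: sub_scalar_def endo_simps algebra_simps)

lemma funpow_sub_scalar_commute:
  assumes "endo T"
  shows "sub_scalar T a ((sub_scalar T b ^^ n) v) = (sub_scalar T b ^^ n) (sub_scalar T a v)"
proof (induction n)
  case (Suc n)
  thus ?case using sub_scalar_commute[OF assms, of a b "(sub_scalar T b ^^ n) v"] by simp
qed simp

lemma subspace_gen_eigenspace:
  assumes "endo T"
  shows "subspace (gen_eigenspace T a)"
proof (rule subspaceI)
  note lin = endo_simps[OF endo_funpow[OF endo_sub_scalar[OF assms]]]
  show "0 \<in> gen_eigenspace T a"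
    by (auto simp: gen_eigenspace_def lin)
  show "scale c v \<in> gen_eigenspace T a" if "v \<in> gen_eigenspace T a" for c v
    using that by (auto simp: gen_eigenspace_def lin)
  show "v + w \<in> gen_eigenspace T a" if vw: "v \<in> gen_eigenspace T a" "w \<in> gen_eigenspace T a" for v w
  proof -
    obtain m n where "(sub_scalar T a ^^ m) v = 0" "(sub_scalar T a ^^ n) w = 0"
      using vw by (auto simp: gen_eigenspace_def)
    hence "(sub_scalar T a ^^ (n + m)) v = 0" "(sub_scalar T a ^^ (m + n)) w = 0"
      by (simp_all only: funpow_add o_apply lin)
    thus ?thesis
      by (auto simp: gen_eigenspace_def lin add.commute intro!: exI[of _ "m + n"])
  qed
qed

lemma sub_scalar_in_gen_eigenspace:
  assumes "endo T" "v \<in> gen_eigenspace T a"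
  shows "sub_scalar T b v \<in> gen_eigenspace T a"
proof -
  obtain n where "(sub_scalar T a ^^ n) v = 0"
    using assms by (auto simp: gen_eigenspace_def)
  hence "(sub_scalar T a ^^ n) (sub_scalar T b v) = 0"
    by (simp add: assms funpow_sub_scalar_commute[symmetric] endo_simps(3)[OF endo_sub_scalar])
  thus ?thesis by (auto simp: gen_eigenspace_def)
qed

lemma gen_eigenspaceI: "sub_scalar T a v \<in> gen_eigenspace T a \<Longrightarrow> v \<in> gen_eigenspace T a"
  unfolding gen_eigenspace_def by (auto simp: funpow_swap1 intro: exI[of _ "Suc _"])

lemma sub_scalar_inj_gen_eigenspace:
  assumes T: "endo T" and "v \<in> gen_eigenspace T a" "sub_scalar T b v = 0" "a \<noteq> b"
  shows "v = 0"
proof -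
  obtain n where n: "(sub_scalar T a ^^ n) v = 0"
    using assms by (auto simp: gen_eigenspace_def)
  have "(sub_scalar T a ^^ n) v = scale ((b - a) ^ n) v"
  proof (induction n)
    case (Suc n)
    have "sub_scalar T a v = scale (b - a) v"
      using assms(3) by (simp add: sub_scalar_def algebra_simps)
    with Suc show ?case
      by (simp add: endo_simps[OF endo_sub_scalar[OF T]] mult.commute)
  qed simp
  with n \<open>a \<noteq> b\<close> show ?thesis by simp
qed

text \<open>On this space \<open>T - b\<close> is the nonzero scalar \<open>a - b\<close> plus the
  locally nilpotent \<open>T - a\<close>. Induction on the nilpotency order of \<open>w\<close>: if
  \<open>v\<close> is a preimage of \<open>(T - a) w\<close>, then \<open>(w - v) / (a - b)\<close>
  is a preimage of \<open>w\<close>.\<close>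

lemma sub_scalar_surj_gen_eigenspace:
  assumes T: "endo T" and "w \<in> gen_eigenspace T a" "a \<noteq> b"
  shows "\<exists>v \<in> gen_eigenspace T a. sub_scalar T b v = w"
proof -
  have "\<exists>v \<in> gen_eigenspace T a. sub_scalar T b v = w" if "(sub_scalar T a ^^ n) w = 0" for n w
    using that
  proof (induction n arbitrary: w)
    case 0
    thus ?case
      using subspace_0[OF subspace_gen_eigenspace[OF T]] endo_simps(3)[OF endo_sub_scalar[OF T]] by auto
  next
    case (Suc n)
    have w: "w \<in> gen_eigenspace T a"
      using Suc.prems unfolding gen_eigenspace_def by blast
    from Suc obtain v where v: "v \<in> gen_eigenspace T a" "sub_scalar T b v = sub_scalar T a w"
      by (auto simp: funpow_swap1)
    let ?u = "scale (inverse (a - b)) (w - v)"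
    have "sub_scalar T b w = sub_scalar T a w + scale (a - b) w"
      by (simp add: sub_scalar_def algebra_simps)
    hence "sub_scalar T b ?u = w"
      using \<open>a \<noteq> b\<close> v by (simp add: endo_simps[OF endo_sub_scalar[OF T]])
    moreover have "?u \<in> gen_eigenspace T a"
      by (intro subspace_scale subspace_diff subspace_gen_eigenspace T v w)
    ultimately show ?case by blast
  qed
  thus ?thesis using assms by (auto simp: gen_eigenspace_def)
qed

section \<open>Products of factors \<open>T - a\<close> and the primary decomposition\<close>

text \<open>A split polynomial in \<open>T\<close>, kept as its list of roots so that one factor can
  be removed at a time; the last entry acts first.\<close>

definition sub_scalars :: "('b \<Rightarrow> 'b) \<Rightarrow> 'a list \<Rightarrow> 'b \<Rightarrow> 'b"
  where "sub_scalars T as v = foldr (sub_scalar T) as v"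

lemma sub_scalars_simps [simp]:
  "sub_scalars T [] v = v" "sub_scalars T (a # as) v = sub_scalar T a (sub_scalars T as v)"
  "sub_scalars T (as @ bs) v = sub_scalars T as (sub_scalars T bs v)"
  by (simp_all add: sub_scalars_def)

lemma endo_sub_scalars: "endo T \<Longrightarrow> endo (sub_scalars T as)"
proof (induction as)
  case Nil
  show ?case by (rule endoI) simp_all
next
  case (Cons a as)
  thus ?case using endo_compose[OF endo_sub_scalar] by (simp add: sub_scalars_def)
qed

lemma sub_scalars_sub_scalar_commute: "endo T \<Longrightarrow> sub_scalars T as (sub_scalar T b v) = sub_scalar T b (sub_scalars T as v)"
  by (induction as) (simp_all add: sub_scalar_commute)

lemma sub_scalars_commute: "endo T \<Longrightarrow> sub_scalars T as (sub_scalars T bs v) = sub_scalars T bs (sub_scalars T as v)"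
  by (induction bs) (simp_all add: sub_scalars_sub_scalar_commute)

text \<open>Primary decomposition, one vector at a time. By induction \<open>(T - a) v\<close> is a
  sum of generalized eigenvectors. Those for other scalars are images under \<open>T - a\<close>;
  the rest is an error inside the generalized eigenspace of \<open>a\<close>, which
  \<open>gen_eigenspaceI\<close> absorbs.\<close>

lemma span_gen_eigenspaces_if_sub_scalars_eq_0:
  assumes T: "endo T" and "sub_scalars T as v = 0"
  shows "v \<in> span (\<Union>a. gen_eigenspace T a)"
  using assms(2)
proof (induction as arbitrary: v rule: rev_induct)
  case Nil
  thus ?case by (simp add: span_zero)
next
  case (snoc a as)
  let ?S = "span (\<Union>a. gen_eigenspace T a)"
  have "sub_scalar T a v \<in> ?S"
    using snoc by simp
  hence "\<exists>u \<in> ?S. sub_scalar T a u - sub_scalar T a v \<in> gen_eigenspace T a"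
  proof (induction rule: span_induct_alt)
    case base
    show ?case
      by (rule bexI[of _ 0])
        (simp_all add: span_zero endo_simps[OF endo_sub_scalar[OF T]] subspace_0[OF subspace_gen_eigenspace[OF T]])
  next
    case (step c x y)
    then obtain u b where u: "u \<in> ?S" "sub_scalar T a u - y \<in> gen_eigenspace T a"
      and x: "x \<in> gen_eigenspace T b" by blast
    show ?case
    proof (cases "a = b")
      case True
      have "sub_scalar T a u - (scale c x + y) = (sub_scalar T a u - y) - scale c x"
        by simp
      also have "\<dots> \<in> gen_eigenspace T a"
        using True x u(2) subspace_gen_eigenspace[OF T]
        by (blast intro: subspace_diff subspace_scale)
      finally show ?thesis using u by blast
    next
      case False
      then obtain x' where x': "x' \<in> gen_eigenspace T b" "sub_scalar T a x' = x"
        using sub_scalar_surj_gen_eigenspace[OF T x, of a] by blast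
      have "scale c x' + u \<in> ?S"
        using x' by (intro span_add span_scale u) (auto intro: span_base)
      moreover have "sub_scalar T a (scale c x' + u) - (scale c x + y) = sub_scalar T a u - y"
        by (simp add: endo_simps[OF endo_sub_scalar[OF T]] x')
      ultimately show ?thesis using u by metis
    qed
  qed
  then obtain u where u: "u \<in> ?S" "sub_scalar T a (u - v) \<in> gen_eigenspace T a"
    by (auto simp: endo_simps[OF endo_sub_scalar[OF T]])
  have "u - v \<in> ?S"
    using gen_eigenspaceI[OF u(2)] by (intro span_base) blast
  from span_diff[OF u(1) this] show ?case by simp
qed

text \<open>A sum of generalized eigenvectors for scalars other than \<open>a\<close> is killed by a
  product of factors \<open>T - b\<close> with \<open>b\<close> different from \<open>a\<close>, and
  each such factor is injective on the generalized eigenspace of \<open>a\<close>.\<close>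

lemma gen_eigenspace_inter_span:
  assumes T: "endo T" and v: "v \<in> gen_eigenspace T a"
    and "v \<in> span (\<Union>b\<in>-{a}. gen_eigenspace T b)"
  shows "v = 0"
proof -
  have "\<exists>bs. a \<notin> set bs \<and> sub_scalars T bs v = 0"
    using assms(3)
  proof (induction rule: span_induct_alt)
    case base
    show ?case by (rule exI[of _ "[]"]) simp
  next
    case (step c x y)
    then obtain b n bs where bs: "b \<noteq> a" "(sub_scalar T b ^^ n) x = 0" "a \<notin> set bs" "sub_scalars T bs y = 0"
      by (auto simp: gen_eigenspace_def)
    have "sub_scalars T (replicate n b) x = 0"
      using bs by (simp add: sub_scalars_def)
    hence "sub_scalars T (bs @ replicate n b) (scale c x + y) = 0"
      using bs(4) sub_scalars_commute[OF T, of bs "replicate n b" y]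
      by (simp add: endo_simps[OF endo_sub_scalars[OF T]])
    thus ?case using bs by (intro exI[of _ "bs @ replicate n b"]) auto
  qed
  then obtain bs where "a \<notin> set bs" "sub_scalars T bs v = 0" by blast
  thus ?thesis using v
  proof (induction bs arbitrary: v rule: rev_induct)
    case (snoc b bs)
    hence "sub_scalar T b v = 0"
      by (auto intro: sub_scalar_in_gen_eigenspace[OF T])
    with snoc show ?case by (auto intro: sub_scalar_inj_gen_eigenspace[OF T])
  qed simp
qed

section \<open>Horner evaluation of polynomials at an operator\<close>

definition poly_endo :: "'a poly \<Rightarrow> ('b \<Rightarrow> 'b) \<Rightarrow> 'b \<Rightarrow> 'b"
  where "poly_endo p T = fold_coeffs (\<lambda>a f v. scale a v + T (f v)) p (\<lambda>v. 0)"

lemma poly_endo_0 [simp]: "poly_endo 0 T v = 0"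
  by (simp add: poly_endo_def)

lemma poly_endo_pCons:
  "endo T \<Longrightarrow> poly_endo (pCons a p) T v = scale a v + T (poly_endo p T v)"
  by (cases "p = 0 \<and> a = 0") (auto simp: poly_endo_def endo_simps)

lemma poly_endo_add: "endo T \<Longrightarrow> poly_endo (p + q) T v = poly_endo p T v + poly_endo q T v"
  by (induction p q rule: poly_induct2) (simp_all add: poly_endo_pCons endo_simps algebra_simps)

lemma poly_endo_smult: "endo T \<Longrightarrow> poly_endo (smult c p) T v = scale c (poly_endo p T v)"
  by (induction p) (simp_all add: poly_endo_pCons endo_simps algebra_simps)

lemma poly_endo_sum: "endo T \<Longrightarrow> poly_endo (\<Sum>i\<in>I. f i) T v = (\<Sum>i\<in>I. poly_endo (f i) T v)"
  by (induction I rule: infinite_finite_induct) (simp_all add: poly_endo_add)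

lemma poly_endo_monom: "endo T \<Longrightarrow> poly_endo (monom c n) T v = scale c ((T ^^ n) v)"
  by (induction n) (simp_all add: monom_0 monom_Suc poly_endo_pCons endo_simps)

lemma poly_endo_commute: "endo T \<Longrightarrow> poly_endo p T (T v) = T (poly_endo p T v)"
  by (induction p) (simp_all add: poly_endo_pCons endo_simps)

lemma endo_poly_endo: "endo T \<Longrightarrow> endo (poly_endo p T)"
  by (rule endoI; induction p) (simp_all add: poly_endo_pCons endo_simps algebra_simps)

lemma poly_endo_root_factor:
  assumes "endo T"
  shows "poly_endo ([:- a, 1:] * p) T v = poly_endo p T (sub_scalar T a v)"
proof -
  have "[:- a, 1:] * p = smult (- a) p + pCons 0 p" by simp
  thus ?thesis
    by (simp only: poly_endo_add[OF assms] poly_endo_smult[OF assms] poly_endo_pCons[OF assms]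
        endo_simps[OF endo_poly_endo[OF assms]] sub_scalar_def poly_endo_commute[OF assms]) simp
qed

end

section \<open>Generalized eigenspaces span over the complex numbers\<close>

locale complex_fd_space = linear_algebra scale + finite_dimensional_vector_space scale Basis
  for scale :: "complex \<Rightarrow> 'b::ab_group_add \<Rightarrow> 'b" and Basis
begin

text \<open>There are \<open>dimension + 1\<close> indices. The family is indexed because iterates
  of an operator may coincide; a repetition gives the relation with coefficients 1 and -1.\<close>

lemma exists_linear_relation:
  fixes f :: "nat \<Rightarrow> 'b"
  shows "\<exists>c. (\<exists>i\<le>dimension. c i \<noteq> 0) \<and> (\<Sum>i\<le>dimension. scale (c i) (f i)) = 0"
proof (cases "inj_on f {..dimension}")
  case True
  have "dependent (f ` {..dimension})"
    using True independent_bound_general dim_subset_UNIV[of "f ` {..dimension}"]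
    by (fastforce simp: card_image)
  then obtain u v where "v \<in> f ` {..dimension}" "u v \<noteq> 0" "(\<Sum>v\<in>f ` {..dimension}. scale (u v) v) = 0"
    by (auto simp: dependent_finite)
  thus ?thesis
    using True by (intro exI[of _ "\<lambda>i. u (f i)"]) (auto simp: sum.reindex)
next
  case False
  then obtain i j where ij: "i \<le> dimension" "j \<le> dimension" "f i = f j" "i \<noteq> j"
    by (auto simp: inj_on_def)
  have "(\<Sum>k\<le>dimension. scale (if k = i then 1 else if k = j then -1 else 0) (f k))
      = (\<Sum>k\<in>{i, j}. scale (if k = i then 1 else if k = j then -1 else 0) (f k))"
    using ij by (intro sum.mono_neutral_right) auto
  also have "\<dots> = 0"
    using ij by simp
  finally show ?thesis
    using ij by (intro exI[of _ "\<lambda>k. if k = i then 1 else if k = j then -1 else 0"]) auto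
qed

text \<open>A root of \<open>p\<close> is split off and its factor applied to \<open>v\<close>,
  which is why the induction on the degree generalizes \<open>v\<close>.\<close>

lemma sub_scalars_eq_0_if_poly_endo_eq_0:
  assumes T: "endo T"
  shows "p \<noteq> 0 \<Longrightarrow> poly_endo p T v = 0 \<Longrightarrow> \<exists>as. sub_scalars T as v = 0"
proof (induction "degree p" arbitrary: p v)
  case 0
  then obtain c where "p = [:c:]" "c \<noteq> 0"
    by (metis degree_eq_zeroE pCons_0_0)
  with 0 have "v = 0"
    by (simp add: poly_endo_pCons[OF T] endo_simps[OF T])
  thus ?case by (intro exI[of _ "[]"]) simp
next
  case (Suc n)
  then obtain a where "poly p a = 0"
    using fundamental_theorem_of_algebra[of p] constant_degree[of p] by auto
  then obtain q where q: "p = [:- a, 1:] * q"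
    by (auto simp: poly_eq_0_iff_dvd)
  have "q \<noteq> 0"
    using Suc.prems q by auto
  hence "degree p = Suc (degree q)"
    unfolding q by (subst degree_mult_eq) auto
  with Suc.hyps(2) have "n = degree q" by simp
  moreover have "poly_endo q T (sub_scalar T a v) = 0"
    using Suc.prems(2) by (simp only: q poly_endo_root_factor[OF T])
  ultimately obtain as where "sub_scalars T as (sub_scalar T a v) = 0"
    using Suc.hyps(1) \<open>q \<noteq> 0\<close> by blast
  thus ?case by (intro exI[of _ "as @ [a]"]) simp
qed

text \<open>Each vector gets its own annihilating polynomial, from a relation among its first
  \<open>dimension + 1\<close> iterates.\<close>

lemma span_gen_eigenspaces:
  assumes T: "endo T"
  shows "span (\<Union>a. gen_eigenspace T a) = UNIV"
proof -
  have "v \<in> span (\<Union>a. gen_eigenspace T a)" for v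
  proof -
    obtain c k where k: "k \<le> dimension" "c k \<noteq> 0"
      and c: "(\<Sum>i\<le>dimension. scale (c i) ((T ^^ i) v)) = 0"
      using exists_linear_relation[of "\<lambda>i. (T ^^ i) v"] by auto
    define p where "p = (\<Sum>i\<le>dimension. monom (c i) i)"
    have "coeff p k = c k"
      using k by (simp add: p_def coeff_sum)
    hence "p \<noteq> 0" using k by auto
    moreover have "poly_endo p T v = 0"
      using c by (simp add: p_def poly_endo_sum[OF T] poly_endo_monom[OF T])
    ultimately show ?thesis
      using sub_scalars_eq_0_if_poly_endo_eq_0[OF T] span_gen_eigenspaces_if_sub_scalars_eq_0[OF T]
      by blast
  qed
  thus ?thesis by blast
qed

section \<open>Coordinates and the trace\<close>

lemma sum_representation:
  assumes "independent B" "span B = UNIV"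
  shows "(\<Sum>b\<in>B. scale (representation B v b) b) = v"
  by (rule sum_representation_eq) (use assms finiteI_independent in auto)

lemma representation_linear:
  assumes "independent B" "span B = UNIV"
  shows "representation B (v + w) b = representation B v b + representation B w b"
    "representation B (v - w) b = representation B v b - representation B w b"
    "representation B (scale c v) b = c * representation B v b"
    "representation B 0 b = 0"
  using assms by (simp_all add: representation_add representation_diff representation_scale representation_zero)

lemma representation_sum_scale:
  assumes "independent B" "span B = UNIV"
  shows "representation B (\<Sum>a\<in>A. scale (c a) (f a)) b = (\<Sum>a\<in>A. c a * representation B (f a) b)"
  using assms by (simp add: representation_sum representation_scale)

definition trace_on :: "'b set \<Rightarrow> ('b \<Rightarrow> 'b) \<Rightarrow> complex"
  where "trace_on B T = (\<Sum>b\<in>B. representation B (T b) b)"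

abbreviation trace :: "('b \<Rightarrow> 'b) \<Rightarrow> complex"
  where "trace \<equiv> trace_on Basis"

text \<open>The two bases may differ: with one operator the identity this gives independence of the
  basis, with equal bases it gives cyclicity.\<close>

lemma trace_on_compose:
  assumes B: "independent B" "span B = UNIV" and C: "independent C" "span C = UNIV"
    and S: "endo S" and T: "endo T"
  shows "trace_on B (\<lambda>v. S (T v)) = trace_on C (\<lambda>v. T (S v))"
proof -
  have *: "representation D (F (G d)) d
      = (\<Sum>e\<in>E. representation E (G d) e * representation D (F e) d)"
    if D: "independent D" "span D = UNIV" and E: "independent E" "span E = UNIV" and F: "endo F"
    for D E F G d
  proof -
    have "F (G d) = F (\<Sum>e\<in>E. scale (representation E (G d) e) e)"
      by (simp add: sum_representation E)
    also have "\<dots> = (\<Sum>e\<in>E. scale (representation E (G d) e) (F e))"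
      by (rule endo_scale_sum[OF F])
    finally show ?thesis
      by (simp add: representation_sum_scale[OF D])
  qed
  have "trace_on B (\<lambda>v. S (T v)) = (\<Sum>b\<in>B. \<Sum>c\<in>C. representation C (T b) c * representation B (S c) b)"
    unfolding trace_on_def by (intro sum.cong *[OF B C S] refl)
  also have "\<dots> = (\<Sum>c\<in>C. \<Sum>b\<in>B. representation B (S c) b * representation C (T b) c)"
    by (subst sum.swap) (simp add: mult.commute)
  also have "\<dots> = trace_on C (\<lambda>v. T (S v))"
    unfolding trace_on_def by (intro sum.cong *[OF C B T, symmetric] refl)
  finally show ?thesis .
qed

lemma endo_id: "endo (\<lambda>v. v)"
  by (rule endoI) simp_all

lemma trace_on_eq:
  "independent B \<Longrightarrow> span B = UNIV \<Longrightarrow> endo T \<Longrightarrow> trace_on B T = trace T"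
  using trace_on_compose[OF _ _ independent_Basis span_Basis _ endo_id] by simp

lemma trace_commute: "endo S \<Longrightarrow> endo T \<Longrightarrow> trace (\<lambda>v. S (T v)) = trace (\<lambda>v. T (S v))"
  by (rule trace_on_compose[OF independent_Basis span_Basis independent_Basis span_Basis])

lemma trace_linear:
  "trace (\<lambda>v. S v + T v) = trace S + trace T"
  "trace (\<lambda>v. S v - T v) = trace S - trace T"
  "trace (\<lambda>v. scale c (T v)) = c * trace T"
  "trace (\<lambda>v. 0) = 0"
  by (simp_all add: trace_on_def representation_linear[OF independent_Basis span_Basis]
      sum.distrib sum_subtractf sum_distrib_left)

lemma trace_sum: "trace (\<lambda>v. \<Sum>a\<in>A. T a v) = (\<Sum>a\<in>A. trace (T a))"
  by (induction A rule: infinite_finite_induct) (simp_all add: trace_linear)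

section \<open>Triangular bases and the conjugate operator\<close>

text \<open>Some generalized eigenvector lies outside \<open>span B\<close>. Apply
  \<open>T - a\<close> to it repeatedly; the last iterate before the first one inside
  \<open>span B\<close> is the vector sought.\<close>

lemma triangular_basis_extend:
  assumes T: "endo T" and B: "independent B" "span B \<noteq> UNIV" and TB: "T ` B \<subseteq> span B"
  shows "\<exists>v a. v \<notin> span B \<and> v \<in> gen_eigenspace T a \<and> sub_scalar T a v \<in> span B"
proof -
  have "\<not> (\<Union>a. gen_eigenspace T a) \<subseteq> span B"
    using span_gen_eigenspaces[OF T] span_minimal[of "\<Union>a. gen_eigenspace T a" "span B"] B by auto
  then obtain u a where u: "u \<in> gen_eigenspace T a" "u \<notin> span B" by auto
  then obtain n where n: "(sub_scalar T a ^^ n) u = 0"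
    by (auto simp: gen_eigenspace_def)
  define k where "k = (LEAST k. (sub_scalar T a ^^ k) u \<in> span B)"
  have k: "(sub_scalar T a ^^ k) u \<in> span B"
    unfolding k_def by (rule LeastI[of _ n]) (simp add: n span_zero)
  have "k \<noteq> 0"
    using u k by (metis funpow_0)
  then obtain j where j: "k = Suc j"
    by (cases k) auto
  have "(sub_scalar T a ^^ j) u \<notin> span B"
    using not_less_Least[of j "\<lambda>k. (sub_scalar T a ^^ k) u \<in> span B"] j by (simp add: k_def)
  moreover have "(sub_scalar T a ^^ i) u \<in> gen_eigenspace T a" for i
    by (induction i) (simp_all add: u sub_scalar_in_gen_eigenspace[OF T])
  moreover have "sub_scalar T a ((sub_scalar T a ^^ j) u) \<in> span B"
    using k j by simp
  ultimately show ?thesis by blast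
qed

text \<open>Each basis vector is a generalized eigenvector; the matrix of \<open>T\<close> is triangular, but only its
  diagonal is recorded.\<close>

lemma triangular_basis:
  assumes T: "endo T"
  obtains B d where "independent B" "span B = UNIV"
    "\<And>b. b \<in> B \<Longrightarrow> b \<in> gen_eigenspace T (d b)"
    "\<And>b. b \<in> B \<Longrightarrow> representation B (T b) b = d b"
proof -
  define P where "P B \<longleftrightarrow> independent B \<and> T ` B \<subseteq> span B \<and>
    (\<exists>d. \<forall>b\<in>B. b \<in> gen_eigenspace T (d b) \<and> representation B (T b) b = d b)" for B
  have "P {}" by (simp add: P_def independent_empty)
  moreover have "card B \<le> dimension" if "P B" for B
    using that independent_bound_general[of B] dim_subset_UNIV[of B] by (auto simp: P_def)
  ultimately obtain B where "P B" and max: "\<And>C. P C \<Longrightarrow> card C \<le> card B"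
    using ex_has_greatest_nat[of P "{}" card "dimension + 1"] by (metis less_add_one le_less_trans)
  then obtain d where B: "independent B" "T ` B \<subseteq> span B"
    and d: "\<And>b. b \<in> B \<Longrightarrow> b \<in> gen_eigenspace T (d b)"
      "\<And>b. b \<in> B \<Longrightarrow> representation B (T b) b = d b"
    by (auto simp: P_def)
  have "span B = UNIV"
  proof (rule ccontr)
    assume "span B \<noteq> UNIV"
    then obtain v a where v: "v \<notin> span B" "v \<in> gen_eigenspace T a" "sub_scalar T a v \<in> span B"
      using triangular_basis_extend[OF T B(1) _ B(2)] by blast
    define C where "C = insert v B"
    have C: "independent C"
      using B v by (simp add: C_def independent_insertI)
    have sub: "span B \<subseteq> span C"
      by (rule span_mono) (auto simp: C_def)
    \<comment> \<open>Old coordinates survive the extension, hence so do the old diagonal entries.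
      Modulo \<open>span B\<close>, \<open>T v\<close> is \<open>a\<close> times \<open>v\<close>,
      so the new entry is \<open>a\<close>.\<close>
    have rep: "representation C w = representation B w" if "w \<in> span B" for w
      using that C by (intro representation_extend) (auto simp: C_def)
    have vB: "v \<notin> B"
      using v(1) by (auto intro: span_base)
    have Tv: "T v = sub_scalar T a v + scale a v"
      by (simp add: sub_scalar_def)
    have vC: "v \<in> span C"
      by (rule span_base) (simp add: C_def)
    have "representation C (T v) v = representation C (sub_scalar T a v) v + a * representation C v v"
      unfolding Tv using C vC v(3) sub
      by (subst representation_add) (auto simp: representation_scale span_scale)
    also have "representation C v v = 1"
      using representation_basis[OF C, of v] by (simp add: C_def)
    also have "representation C (sub_scalar T a v) v = 0"
      using rep[OF v(3)] vB representation_ne_zero[of B "sub_scalar T a v" v] by auto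
    finally have "representation C (T v) v = a" by simp
    moreover have "T v \<in> span C"
      unfolding Tv using v(3) sub vC by (intro span_add span_scale) auto
    moreover have "representation C (T b) b = d b" "T b \<in> span C" if "b \<in> B" for b
      using that d(2) rep[of "T b"] B(2) sub by auto
    ultimately have "P C"
      unfolding P_def using C v d vB
      by (auto simp: C_def intro!: exI[of _ "d(v := a)"])
    from max[OF this] show False
      using vB finiteI_independent[OF B(1)] by (simp add: C_def)
  qed
  thus ?thesis using that B d by blast
qed

text \<open>\<open>S\<close> is diagonal in a triangular basis of \<open>T\<close>, with the
  conjugates of the diagonal entries of \<open>T\<close>. It acts as a scalar on a whole generalized
  eigenspace because vectors there have coordinates only at basis vectors of the same
  eigenvalue.\<close>

lemma conjugate_operator:
  assumes T: "endo T"
  obtains S B d where "endo S" "independent B" "span B = UNIV"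
    "\<And>b. b \<in> B \<Longrightarrow> b \<in> gen_eigenspace T (d b)"
    "\<And>a v. v \<in> gen_eigenspace T a \<Longrightarrow> S v = scale (cnj a) v"
    "trace (\<lambda>v. T (S v)) = (\<Sum>b\<in>B. of_real ((cmod (d b))\<^sup>2))"
proof -
  obtain B d where B: "independent B" "span B = UNIV"
    and d: "\<And>b. b \<in> B \<Longrightarrow> b \<in> gen_eigenspace T (d b)"
      "\<And>b. b \<in> B \<Longrightarrow> representation B (T b) b = d b"
    using triangular_basis[OF T] by metis
  note fin = finiteI_independent[OF B(1)]
  define S where "S v = (\<Sum>b\<in>B. scale (representation B v b * cnj (d b)) b)" for v
  have S: "endo S"
    by (rule endoI) (simp_all add: S_def representation_linear[OF B] scale_left_distrib
        sum.distrib scale_sum_right algebra_simps)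
  have S_eq: "S v = scale (cnj a) v" if v: "v \<in> gen_eigenspace T a" for a v
  proof -
    \<comment> \<open>The part of \<open>v\<close> with foreign eigenvalues. It lies in the
      generalized eigenspace of \<open>a\<close> and in the span of the others, so it is
      zero.\<close>
    define u where "u = (\<Sum>b\<in>{b\<in>B. d b \<noteq> a}. scale (representation B v b) b)"
    have "v = (\<Sum>b\<in>B. scale (representation B v b) b)"
      by (simp add: sum_representation B)
    also have "\<dots> = u + (\<Sum>b\<in>{b\<in>B. d b = a}. scale (representation B v b) b)"
      unfolding u_def using fin
      by (subst sum.union_disjoint[symmetric]) (auto intro!: sum.cong)
    finally have "u = v - (\<Sum>b\<in>{b\<in>B. d b = a}. scale (representation B v b) b)"
      by (simp add: algebra_simps)
    also have "\<dots> \<in> gen_eigenspace T a"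
      using d(1) v by (intro subspace_diff[OF subspace_gen_eigenspace[OF T]]
          subspace_sum[OF subspace_gen_eigenspace[OF T]]
          subspace_scale[OF subspace_gen_eigenspace[OF T]]) auto
    finally have "u \<in> gen_eigenspace T a" .
    moreover have "u \<in> span (\<Union>b\<in>-{a}. gen_eigenspace T b)"
      unfolding u_def by (intro span_sum span_scale span_base) (use d(1) in auto)
    ultimately have "u = 0"
      by (rule gen_eigenspace_inter_span[OF T])
    hence zero: "representation B v b = 0" if "b \<in> B" "d b \<noteq> a" for b
      using that fin independentD[OF B(1), of "{b\<in>B. d b \<noteq> a}" "representation B v" b]
      unfolding u_def by auto
    have "S v = (\<Sum>b\<in>B. scale (cnj a) (scale (representation B v b) b))"
      unfolding S_def by (intro sum.cong refl) (use zero in \<open>auto simp: mult.commute\<close>)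
    also have "\<dots> = scale (cnj a) (\<Sum>b\<in>B. scale (representation B v b) b)"
      by (rule scale_sum_right[symmetric])
    finally show ?thesis
      by (simp only: sum_representation[OF B])
  qed
  have "trace (\<lambda>v. T (S v)) = trace_on B (\<lambda>v. T (S v))"
    by (rule trace_on_eq[symmetric]) (simp_all add: B endo_compose[OF T S])
  \<comment> \<open>Since \<open>S b\<close> is \<open>cnj (d b)\<close> times \<open>b\<close>, the
    diagonal entry of the composition at \<open>b\<close> is \<open>d b\<close> times its
    conjugate.\<close>
  also have "\<dots> = (\<Sum>b\<in>B. of_real ((cmod (d b))\<^sup>2))"
    unfolding trace_on_def
    by (intro sum.cong refl)
      (simp add: S_eq[OF d(1)] endo_simps[OF T] representation_linear[OF B] d(2)
        complex_norm_square mult.commute del: of_real_power)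
  finally show ?thesis
    using that S B d(1) S_eq by blast
qed

lemma nilpotent_if_trace_conjugate_eq_0:
  assumes B: "span B = UNIV" and fin: "finite B"
    and d: "\<And>b. b \<in> B \<Longrightarrow> b \<in> gen_eigenspace T (d b)"
    and T: "endo T" and zero: "(\<Sum>b\<in>B. of_real ((cmod (d b))\<^sup>2)) = (0 :: complex)"
  shows "gen_eigenspace T 0 = UNIV"
proof -
  have "(\<Sum>b\<in>B. (cmod (d b))\<^sup>2) = 0"
    using zero by (simp only: of_real_sum[symmetric] of_real_eq_0_iff)
  hence "d b = 0" if "b \<in> B" for b
    using that fin by (simp add: sum_nonneg_eq_0_iff)
  hence "B \<subseteq> gen_eigenspace T 0"
    using d by force
  from span_minimal[OF this subspace_gen_eigenspace[OF T]] show ?thesis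
    using B by auto
qed

lemma gen_eigenspace_0_nilpotent:
  assumes T: "endo T" and "gen_eigenspace T 0 = UNIV"
  obtains n where "\<And>v. (T ^^ n) v = 0"
proof -
  have "\<forall>v. \<exists>n. (T ^^ n) v = 0"
    using assms(2) by (auto simp: gen_eigenspace_def sub_scalar_def[abs_def])
  then obtain N where N: "\<And>v. (T ^^ N v) v = 0" by metis
  \<comment> \<open>A uniform exponent. For an empty \<open>Basis\<close> the value of
    \<open>Max\<close> is irrelevant, as the claim on basis vectors is vacuous.\<close>
  define n where "n = Max (N ` Basis)"
  have "(T ^^ n) b = 0" if "b \<in> Basis" for b
  proof -
    have "N b \<le> n"
      using that finite_Basis by (auto simp: n_def)
    hence "(T ^^ n) b = (T ^^ (n - N b)) ((T ^^ N b) b)"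
      by (metis funpow_add le_add_diff_inverse2 o_apply)
    thus ?thesis by (simp add: N endo_simps[OF endo_funpow[OF T]])
  qed
  hence "(T ^^ n) v = 0" for v
    using endo_eq_on_span[OF endo_funpow[OF T, of n], of "\<lambda>_. 0" Basis v] span_Basis
      endoI[of "\<lambda>_. 0"] by simp
  thus ?thesis using that by blast
qed

end

section \<open>Engel's theorem and Cartan's criterion\<close>

context lie_algebra
begin

lemma linear_bracket: "Vector_Spaces.linear scale scale (bracket x)"
  and linear_bracket_left: "Vector_Spaces.linear scale scale (\<lambda>x. bracket x y)"
  using bracket_bilinear unfolding bilinear_map_def by blast+

lemma bracket_simps:
  "bracket (x + x') y = bracket x y + bracket x' y" "bracket x (y + y') = bracket x y + bracket x y'"
  "bracket (x - x') y = bracket x y - bracket x' y" "bracket x (y - y') = bracket x y - bracket x y'"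
  "bracket (scale c x) y = scale c (bracket x y)" "bracket x (scale c y) = scale c (bracket x y)"
  "bracket 0 y = 0" "bracket x 0 = 0" "bracket (- x) y = - bracket x y" "bracket x (- y) = - bracket x y"
proof -
  interpret l: Vector_Spaces.linear scale scale "\<lambda>x. bracket x y" for y by (rule linear_bracket_left)
  interpret r: Vector_Spaces.linear scale scale "bracket x" for x by (rule linear_bracket)
  show "bracket (x + x') y = bracket x y + bracket x' y" "bracket x (y + y') = bracket x y + bracket x y'"
    "bracket (x - x') y = bracket x y - bracket x' y" "bracket x (y - y') = bracket x y - bracket x y'"
    "bracket (scale c x) y = scale c (bracket x y)" "bracket x (scale c y) = scale c (bracket x y)"
    "bracket 0 y = 0" "bracket x 0 = 0" "bracket (- x) y = - bracket x y" "bracket x (- y) = - bracket x y"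
    by (simp_all add: l.add r.add l.diff r.diff l.scale r.scale l.neg r.neg)
qed

lemma bracket_antisym: "bracket x y = - bracket y x"
proof -
  have "bracket (x + y) (x + y) = bracket x y + bracket y x"
    using bracket_self[of x] bracket_self[of y] by (simp add: bracket_simps)
  thus ?thesis by (simp only: bracket_self eq_neg_iff_add_eq_0)
qed

lemma abelian_solvable:
  assumes "\<And>x y. x \<in> I \<Longrightarrow> y \<in> I \<Longrightarrow> bracket x y = 0"
  shows "solvable I"
proof -
  have "span {bracket x y | x y. x \<in> I \<and> y \<in> I} \<subseteq> {0}"
    by (rule span_minimal) (use assms in auto)
  hence "derived_series I 1 = {0}"
    using span_zero by auto
  thus ?thesis unfolding solvable_def by blast
qed

lemma derived_series_Suc: "derived_series I (Suc n) = derived_series (derived_series I 1) n"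
  by (induction n) simp_all

lemma center_trivial:
  assumes semisimple and z: "\<And>x. bracket x z = 0"
  shows "z = 0"
proof -
  let ?Z = "{z. \<forall>x. bracket x z = 0}"
  have "lie_ideal ?Z"
    unfolding lie_ideal_def by (auto intro!: subspaceI simp: bracket_simps)
  moreover have "solvable ?Z"
    by (rule abelian_solvable) auto
  ultimately have "?Z = {0}"
    using assms(1) unfolding semisimple_def by blast
  thus ?thesis using z by auto
qed

end

locale fd_lie_module =
  lie_module scale bracket scaleM act + complex_fd_space scale BasisG + M: complex_fd_space scaleM BasisM
  for scale :: "complex \<Rightarrow> 'g::ab_group_add \<Rightarrow> 'g" and bracket
    and scaleM :: "complex \<Rightarrow> 'm::ab_group_add \<Rightarrow> 'm" and act and BasisG BasisM
begin

lemma endo_act: "M.endo (act x)"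
  and linear_act_left: "Vector_Spaces.linear scale scaleM (\<lambda>x. act x v)"
  using act_bilinear unfolding bilinear_map_def by blast+

lemma act_simps:
  "act (x + y) v = act x v + act y v" "act (x - y) v = act x v - act y v"
  "act (scale c x) v = scaleM c (act x v)" "act 0 v = 0"
  "act x (v + w) = act x v + act x w" "act x (v - w) = act x v - act x w"
  "act x (scaleM c v) = scaleM c (act x v)" "act x 0 = 0"
proof -
  interpret l: Vector_Spaces.linear scale scaleM "\<lambda>x. act x v" by (rule linear_act_left)
  show "act (x + y) v = act x v + act y v" "act (x - y) v = act x v - act y v"
    "act (scale c x) v = scaleM c (act x v)" "act 0 v = 0"
    by (simp_all add: l.add l.diff l.scale)
qed (simp_all add: M.endo_simps[OF endo_act])

section \<open>A filtration of the module and Engel's theorem\<close>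

text \<open>The vectors annihilated by all products of \<open>k\<close> operators
  \<open>act s\<close> with \<open>s\<close> in \<open>S\<close>. The equation
  \<open>kill S N = UNIV\<close> is the conclusion of Engel's theorem: all products of length
  \<open>N\<close> vanish.\<close>

primrec kill :: "'g set \<Rightarrow> nat \<Rightarrow> 'm set"
  where
    "kill S 0 = {0}"
  | "kill S (Suc k) = {v. \<forall>s\<in>S. act s v \<in> kill S k}"

lemma subspace_kill: "M.subspace (kill S k)"
proof (induction k)
  case (Suc k)
  thus ?case
    by (intro M.subspaceI)
      (auto simp: act_simps M.subspace_0 intro: M.subspace_add M.subspace_scale)
qed simp

lemma kill_Suc_mono: "kill S k \<subseteq> kill S (Suc k)"
  by (induction k) (auto simp: act_simps)

lemma kill_mono: "j \<le> k \<Longrightarrow> kill S j \<subseteq> kill S k"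
  by (rule lift_Suc_mono_le[of "kill S"]) (rule kill_Suc_mono)

text \<open>The shift \<open>N\<close> makes room for elements that raise the filtration \<open>kill S\<close>; they start at
  \<open>j = 0\<close>, and each bracket with an element of \<open>S\<close> lowers them by one.\<close>

definition lowers :: "'g set \<Rightarrow> nat \<Rightarrow> nat \<Rightarrow> 'g \<Rightarrow> bool"
  where "lowers S N j t \<longleftrightarrow> (\<forall>k. \<forall>v\<in>kill S k. act t v \<in> kill S (k + N - j))"

lemma lowersD: "lowers S N j t \<Longrightarrow> v \<in> kill S k \<Longrightarrow> act t v \<in> kill S (k + N - j)"
  by (simp add: lowers_def)

lemma lowers_mem: "s \<in> S \<Longrightarrow> lowers S 0 1 s"
  unfolding lowers_def
proof (intro allI ballI)
  fix k v assume "s \<in> S" "v \<in> kill S k"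
  thus "act s v \<in> kill S (k + 0 - 1)"
    by (cases k) (auto simp: act_simps)
qed

lemma lowers_bracket:
  assumes x: "lowers S N i x" and y: "lowers S 0 j y"
  shows "lowers S N (i + j) (bracket x y)"
  unfolding lowers_def
proof (intro allI ballI)
  fix k v assume v: "v \<in> kill S k"
  \<comment> \<open>Truncated subtraction forces the case split: for \<open>k < j\<close> the
    element \<open>y\<close> sends \<open>v\<close> into \<open>kill S 0\<close>, that is, to
    zero.\<close>
  have "act x (act y v) \<in> kill S (k + N - (i + j))"
  proof (cases "j \<le> k")
    case True
    hence "k - j + N - i = k + N - (i + j)" by simp
    thus ?thesis using lowersD[OF x lowersD[OF y v]] by simp
  next
    case False
    hence "act y v = 0" using lowersD[OF y v] by simp
    thus ?thesis by (simp add: act_simps M.subspace_0[OF subspace_kill])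
  qed
  moreover have "act y (act x v) \<in> kill S (k + N - (i + j))"
    using lowersD[OF y lowersD[OF x v]] by (simp add: diff_diff_left)
  ultimately show "act (bracket x y) v \<in> kill S (k + N - (i + j))"
    by (simp add: act_bracket M.subspace_diff[OF subspace_kill])
qed

lemma lowers_uminus: "lowers S N j x \<Longrightarrow> lowers S N j (- x)"
proof -
  have "act (- x) v = - act x v" for v
    using act_simps(2)[of 0 x v] by (simp add: act_simps(4))
  thus "lowers S N j x \<Longrightarrow> lowers S N j (- x)"
    by (simp add: lowers_def M.subspace_neg[OF subspace_kill])
qed

lemma subspace_lowers: "subspace {x. lowers S N j x}"
  by (rule subspaceI)
    (auto simp: lowers_def act_simps M.subspace_0[OF subspace_kill]
      intro: M.subspace_add[OF subspace_kill] M.subspace_scale[OF subspace_kill])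

definition faithful :: bool
  where "faithful \<longleftrightarrow> (\<forall>x. (\<forall>v. act x v = 0) \<longrightarrow> x = 0)"

text \<open>Each further derived term lowers the filtration by at least one more level; brackets
  even double the depth, but one level suffices. At depth \<open>N + 2\<close> everything lands in
  \<open>kill S 0\<close>, so faithfulness leaves only zero.\<close>

lemma solvable_if_kill:
  assumes faithful and "kill S N = UNIV"
  shows "solvable S"
proof -
  have "derived_series S n \<subseteq> {x. lowers S 0 (Suc n) x}" for n
  proof (induction n)
    case 0
    show ?case by (auto dest: lowers_mem)
  next
    case (Suc n)
    have "bracket x y \<in> {x. lowers S 0 (Suc (Suc n)) x}"
      if "x \<in> derived_series S n" "y \<in> derived_series S n" for x y
    proof -
      have "lowers S 0 (Suc n + Suc n) (bracket x y)"
        using Suc that by (intro lowers_bracket) auto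
      moreover have "kill S (k - (Suc n + Suc n)) \<subseteq> kill S (k - Suc (Suc n))" for k
        by (rule kill_mono) simp
      ultimately show ?thesis
        unfolding lowers_def by auto
    qed
    thus ?case
      unfolding derived_series.simps by (intro span_minimal subspace_lowers) auto
  qed
  moreover have "x = 0" if "lowers S 0 (Suc (Suc N)) x" for x
  proof -
    have "act x v = 0" for v
      using lowersD[OF that, of v N] assms(2) by simp
    thus ?thesis using assms(1) by (simp add: faithful_def)
  qed
  ultimately have "derived_series S (Suc N) \<subseteq> {0}"
    by blast
  moreover have "0 \<in> derived_series S (Suc N)"
    by (simp add: span_zero)
  ultimately show ?thesis
    unfolding solvable_def by blast
qed

text \<open>If nothing in \<open>P\<close> outside \<open>S\<close> normalizes \<open>S\<close>,
  then from any element of \<open>P\<close> outside \<open>S\<close> one can bracket with elements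
  of \<open>S\<close> forever and stay outside. Each bracket lowers by one more level, until the
  element acts as zero.\<close>

lemma normalizing_element:
  assumes faithful and S: "subspace S" and "S \<subseteq> P" "S \<noteq> P"
    and P: "\<And>x y. x \<in> P \<Longrightarrow> y \<in> P \<Longrightarrow> bracket x y \<in> P" and N: "kill S N = UNIV"
  obtains z where "z \<in> P" "z \<notin> S" "\<And>s. s \<in> S \<Longrightarrow> bracket s z \<in> S"
proof -
  obtain z0 where z0: "z0 \<in> P" "z0 \<notin> S"
    using assms(3,4) by blast
  have "\<exists>z \<in> P - S. \<forall>s\<in>S. bracket s z \<in> S"
  proof (rule ccontr)
    assume neg: "\<not> ?thesis"
    have "\<exists>z \<in> P - S. lowers S N j z" for j
    proof (induction j)
      case 0
      have "kill S (k + N) = UNIV" for k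
        using kill_mono[of N "k + N" S] N by auto
      hence "lowers S N 0 z0" by (simp add: lowers_def)
      thus ?case using z0 by blast
    next
      case (Suc j)
      then obtain z where z: "z \<in> P - S" "lowers S N j z" by blast
      with neg obtain s where s: "s \<in> S" "bracket s z \<notin> S" by blast
      have "lowers S N (j + 1) (- bracket z s)"
        by (intro lowers_uminus lowers_bracket lowers_mem z s)
      hence "lowers S N (Suc j) (bracket s z)"
        using bracket_antisym[of s z] by simp
      moreover have "bracket s z \<in> P"
        using P s z assms(3) by blast
      ultimately show ?case using s by blast
    qed
    \<comment> \<open>One \<open>N\<close> cancels the shift, the other the height of the
      filtration.\<close>
    then obtain z where z: "z \<notin> S" "lowers S N (N + N) z" by blast
    have "act z v = 0" for v
      using lowersD[OF z(2), of v N] N by simp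
    hence "z = 0"
      using assms(1) by (simp add: faithful_def)
    thus False using z(1) subspace_0[OF S] by simp
  qed
  thus ?thesis using that by blast
qed

lemma kill_normalized:
  assumes "\<And>s. s \<in> S \<Longrightarrow> bracket s z \<in> S"
  shows "v \<in> kill S k \<Longrightarrow> act z v \<in> kill S k"
proof (induction k arbitrary: v)
  case (Suc k)
  have "act s (act z v) \<in> kill S k" if s: "s \<in> S" for s
  proof -
    have "act s (act z v) = act z (act s v) + act (bracket s z) v"
      by (simp add: act_bracket)
    also have "\<dots> \<in> kill S k"
      using Suc assms s by (intro M.subspace_add[OF subspace_kill]) auto
    finally show ?thesis .
  qed
  thus ?case by simp
qed (simp add: act_simps)

text \<open>One level for \<open>S\<close> costs at most \<open>m\<close> levels for the extended
  space: \<open>z\<close> preserves \<open>kill S k\<close> by \<open>kill_normalized\<close> and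
  can be applied fewer than \<open>m\<close> times, while each element of \<open>S\<close> drops a
  level. The inner induction is on the nilpotency order of \<open>v\<close> under
  \<open>z\<close>.\<close>

lemma kill_insert:
  assumes S: "subspace S" and z: "\<And>s. s \<in> S \<Longrightarrow> bracket s z \<in> S"
    and m: "\<And>v. (act z ^^ m) v = 0"
  shows "kill S k \<subseteq> kill (span (insert z S)) (m * k)"
proof (induction k)
  case (Suc k)
  let ?T = "span (insert z S)"
  have "v \<in> kill ?T (j + m * k)" if "v \<in> kill S (Suc k)" "(act z ^^ j) v = 0" for j v
    using that
  proof (induction j arbitrary: v)
    case 0
    thus ?case by (simp add: M.subspace_0[OF subspace_kill])
  next
    case (Suc j)
    have "act t v \<in> kill ?T (j + m * k)" if t: "t \<in> ?T" for t
    proof -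
      obtain c where c: "t - scale c z \<in> S"
        using t S by (auto simp: span_breakdown_eq span_eq_iff[THEN iffD2])
      have "act (t - scale c z) v \<in> kill S k"
        using c Suc.prems by simp
      hence "act (t - scale c z) v \<in> kill ?T (j + m * k)"
        using \<open>kill S k \<subseteq> _\<close> kill_mono[of "m * k" "j + m * k" ?T] by auto
      moreover have "act z v \<in> kill ?T (j + m * k)"
        using Suc.prems by (intro Suc.IH kill_normalized z) (auto simp: funpow_swap1)
      moreover have "act t v = act (t - scale c z) v + scaleM c (act z v)"
        by (simp add: act_simps)
      ultimately show ?thesis
        by (simp add: M.subspace_add[OF subspace_kill] M.subspace_scale[OF subspace_kill])
    qed
    thus ?case by simp
  qed
  thus ?case
    using m by auto
qed (simp add: M.subspace_0)

text \<open>A subalgebra of \<open>P\<close> of largest dimension with the desired property must be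
  \<open>P\<close>: otherwise adjoining a normalizing element gives a larger subalgebra, to which
  \<open>kill_insert\<close> applies.\<close>

theorem engel:
  assumes faithful and P: "subspace P" "\<And>x y. x \<in> P \<Longrightarrow> y \<in> P \<Longrightarrow> bracket x y \<in> P"
    and nil: "\<And>x. x \<in> P \<Longrightarrow> M.gen_eigenspace (act x) 0 = UNIV"
  shows "\<exists>N. kill P N = UNIV"
proof -
  define Q where "Q S \<longleftrightarrow> subspace S \<and> S \<subseteq> P \<and> (\<forall>x\<in>S. \<forall>y\<in>S. bracket x y \<in> S) \<and>
    (\<exists>N. kill S N = UNIV)" for S
  have "Q {0}"
    using P subspace_0 by (auto simp: Q_def bracket_simps act_simps intro!: exI[of _ 1])
  then obtain S where "Q S" and max: "\<And>T. Q T \<Longrightarrow> dim T \<le> dim S"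
    using ex_has_greatest_nat[of Q "{0}" dim "dimension + 1"] dim_subset_UNIV
    by (metis less_add_one le_less_trans)
  then obtain N where S: "subspace S" "S \<subseteq> P" "\<And>x y. x \<in> S \<Longrightarrow> y \<in> S \<Longrightarrow> bracket x y \<in> S"
    and N: "kill S N = UNIV"
    by (auto simp: Q_def)
  have "S = P"
  proof (rule ccontr)
    assume "S \<noteq> P"
    then obtain z where z: "z \<in> P" "z \<notin> S" "\<And>s. s \<in> S \<Longrightarrow> bracket s z \<in> S"
      using normalizing_element[OF assms(1) S(1,2) _ P(2) N] by blast
    obtain m where m: "\<And>v. (act z ^^ m) v = 0"
      using M.gen_eigenspace_0_nilpotent[OF endo_act nil[OF z(1)]] by blast
    let ?T = "span (insert z S)"
    have "bracket x y \<in> ?T" if xy_mem: "x \<in> ?T" "y \<in> ?T" for x y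
    proof -
      obtain b c where bc: "x - scale b z \<in> S" "y - scale c z \<in> S"
        using xy_mem S(1) by (auto simp: span_breakdown_eq span_eq_iff[THEN iffD2])
      define s t where "s = x - scale b z" and "t = y - scale c z"
      have xy: "x = s + scale b z" "y = t + scale c z" "s \<in> S" "t \<in> S"
        using bc by (simp_all add: s_def t_def)
      have "bracket x y = bracket s t + scale c (bracket s z) - scale b (bracket t z)"
        using bracket_antisym[of z t] by (simp add: xy(1,2) bracket_simps bracket_self)
      also have "\<dots> \<in> S"
        using xy(3,4) z(3) S(3) by (intro subspace_add[OF S(1)] subspace_diff[OF S(1)] subspace_scale[OF S(1)]) auto
      finally show ?thesis by (auto intro: span_base)
    qed
    moreover have "?T \<subseteq> P"
      using z S(2) by (intro span_minimal P(1)) auto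
    moreover have "kill ?T (m * N) = UNIV"
      using kill_insert[OF S(1) z(3) m, of N] N by auto
    ultimately have "Q ?T" unfolding Q_def by blast
    from max[OF this] show False
      using z(2) S(1) by (simp add: dim_insert span_eq_iff[THEN iffD2])
  qed
  thus ?thesis using N by blast
qed

section \<open>Trace forms and Cartan's criterion\<close>

definition trace_form :: "'g \<Rightarrow> 'g \<Rightarrow> complex"
  where "trace_form x y = M.trace (\<lambda>v. act x (act y v))"

lemma trace_form_simps:
  "trace_form (x + x') y = trace_form x y + trace_form x' y"
  "trace_form x (y + y') = trace_form x y + trace_form x y'"
  "trace_form (x - x') y = trace_form x y - trace_form x' y"
  "trace_form x (y - y') = trace_form x y - trace_form x y'"
  "trace_form (scale c x) y = c * trace_form x y"
  "trace_form x (scale c y) = c * trace_form x y"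
  "trace_form 0 y = 0" "trace_form x 0 = 0"
  by (simp_all add: trace_form_def act_simps M.trace_linear)

lemma trace_form_commute: "trace_form x y = trace_form y x"
  unfolding trace_form_def by (rule M.trace_commute) (rule endo_act)+

lemma trace_form_sum:
  "trace_form x (\<Sum>a\<in>A. scale (c a) (f a)) = (\<Sum>a\<in>A. c a * trace_form x (f a))"
  by (induction A rule: infinite_finite_induct) (simp_all add: trace_form_simps)

lemma endo_act2: "M.endo (\<lambda>v. act x (act y v))"
  by (rule M.endo_compose) (rule endo_act)+

lemma trace_form_invariant: "trace_form (bracket x y) z = trace_form x (bracket y z)"
proof -
  have "trace_form (bracket x y) z
      = M.trace (\<lambda>v. act x (act y (act z v))) - M.trace (\<lambda>v. act y (act x (act z v)))"
    by (simp add: trace_form_def act_bracket M.trace_linear)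
  also have "M.trace (\<lambda>v. act y (act x (act z v))) = M.trace (\<lambda>v. act x (act z (act y v)))"
    by (rule M.trace_commute) (rule endo_act endo_act2)+
  finally show ?thesis
    by (simp add: trace_form_def act_bracket act_simps M.trace_linear)
qed

text \<open>Leibniz rule: \<open>act x - (a + b)\<close> on \<open>act u v\<close> is the sum of the
  terms with \<open>bracket x - a\<close> applied to \<open>u\<close> and with
  \<open>act x - b\<close> applied to \<open>v\<close>. Each lowers one of the two nilpotency
  orders, hence the induction on \<open>m + n\<close>.\<close>

lemma act_gen_eigenspace:
  assumes "u \<in> gen_eigenspace (bracket x) a" "v \<in> M.gen_eigenspace (act x) b"
  shows "act u v \<in> M.gen_eigenspace (act x) (a + b)"
proof -
  have "act u v \<in> M.gen_eigenspace (act x) (a + b)"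
    if "(sub_scalar (bracket x) a ^^ m) u = 0" "(M.sub_scalar (act x) b ^^ n) v = 0" for m n u v
    using that
  proof (induction "m + n" arbitrary: m n u v rule: less_induct)
    case less
    show ?case
    proof (cases m)
      case 0
      thus ?thesis
        using less.prems by (simp add: act_simps M.subspace_0 M.subspace_gen_eigenspace endo_act)
    next
      case (Suc m')
      show ?thesis
      proof (cases n)
        case 0
        thus ?thesis
          using less.prems by (simp add: act_simps M.subspace_0 M.subspace_gen_eigenspace endo_act)
      next
        case (Suc n')
        have "act (sub_scalar (bracket x) a u) v \<in> M.gen_eigenspace (act x) (a + b)"
          by (rule less.hyps[of m' n]) (use \<open>m = Suc m'\<close> less.prems in \<open>simp_all add: funpow_swap1\<close>)
        moreover have "act u (M.sub_scalar (act x) b v) \<in> M.gen_eigenspace (act x) (a + b)"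
          by (rule less.hyps[of m n']) (use Suc less.prems in \<open>simp_all add: funpow_swap1\<close>)
        moreover have "M.sub_scalar (act x) (a + b) (act u v)
            = act (sub_scalar (bracket x) a u) v + act u (M.sub_scalar (act x) b v)"
          by (simp add: M.sub_scalar_def sub_scalar_def act_simps act_bracket M.scale_left_distrib)
        ultimately show ?thesis
          using M.subspace_add[OF M.subspace_gen_eigenspace[OF endo_act]]
          by (simp add: M.gen_eigenspaceI)
      qed
    qed
  qed
  thus ?thesis
    using assms unfolding gen_eigenspace_def M.gen_eigenspace_def by blast
qed

text \<open>With \<open>S\<close> acting on the generalized eigenspaces of \<open>act x\<close> by conjugate eigenvalues, the commutator of
  \<open>act v\<close> and \<open>S\<close> is a multiple of \<open>act v\<close> for each generalized eigenvector \<open>v\<close> of \<open>bracket x\<close>. Hence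
  the trace of \<open>act x\<close> composed with \<open>S\<close>, which is the sum of the squared moduli of the eigenvalues, is zero.\<close>

lemma nilpotent_if_trace_form_eq_0:
  assumes K: "\<And>u y. u \<in> K \<Longrightarrow> trace_form u y = 0"
    and x: "x \<in> span {bracket u v | u v. u \<in> K}"
  shows "M.gen_eigenspace (act x) 0 = UNIV"
proof -
  obtain S B d where S: "M.endo S" and B: "M.independent B" "M.span B = UNIV"
    and d: "\<And>b. b \<in> B \<Longrightarrow> b \<in> M.gen_eigenspace (act x) (d b)"
    and S_eq: "\<And>a v. v \<in> M.gen_eigenspace (act x) a \<Longrightarrow> S v = scaleM (cnj a) v"
    and tr: "M.trace (\<lambda>v. act x (S v)) = (\<Sum>b\<in>B. of_real ((cmod (d b))\<^sup>2))"
    by (rule M.conjugate_operator[OF endo_act[of x]]) (rule that)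
  have comm: "act v (S w) - S (act v w) = scaleM (- cnj a) (act v w)"
    if v: "v \<in> gen_eigenspace (bracket x) a" for v a w
  proof (rule M.endo_eq_on_span[where S = "\<lambda>w. act v (S w) - S (act v w)"
        and T = "\<lambda>w. scaleM (- cnj a) (act v w)" and B = B])
    show "M.endo (\<lambda>w. act v (S w) - S (act v w))"
      by (rule M.endo_diff[OF M.endo_compose[OF endo_act S] M.endo_compose[OF S endo_act]])
    show "M.endo (\<lambda>w. scaleM (- cnj a) (act v w))"
      by (rule M.endoI) (simp_all add: act_simps algebra_simps)
    \<comment> \<open>\<open>act v b\<close> belongs to the eigenvalue \<open>a + d b\<close>, so
      the difference of conjugates is \<open>cnj (d b) - cnj (a + d b) = - cnj a\<close>.\<close>
    show "act v (S b) - S (act v b) = scaleM (- cnj a) (act v b)" if "b \<in> B" for b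
      using S_eq[OF d[OF that]] S_eq[OF act_gen_eigenspace[OF v d[OF that]]]
      by (simp add: act_simps M.scale_left_distrib)
  qed (simp add: B)
  have zero: "M.trace (\<lambda>w. act (bracket u v) (S w)) = 0" if u: "u \<in> K" for u v
  proof -
    have "v \<in> span (\<Union>a. gen_eigenspace (bracket x) a)"
      by (simp add: span_gen_eigenspaces linear_bracket)
    thus ?thesis
    proof (induction rule: span_induct_alt)
      case base
      show ?case by (simp add: bracket_simps act_simps M.trace_linear)
    next
      case (step c v v')
      then obtain a where a: "v \<in> gen_eigenspace (bracket x) a" by blast
      have "M.trace (\<lambda>w. act (bracket u v) (S w))
          = M.trace (\<lambda>w. act u (act v (S w))) - M.trace (\<lambda>w. act v (act u (S w)))"
        by (simp add: act_bracket M.trace_linear)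
      also have "M.trace (\<lambda>w. act v (act u (S w))) = M.trace (\<lambda>w. act u (S (act v w)))"
        by (rule M.trace_commute[OF endo_act M.endo_compose[OF endo_act S]])
      also have "M.trace (\<lambda>w. act u (act v (S w))) - M.trace (\<lambda>w. act u (S (act v w)))
          = M.trace (\<lambda>w. act u (act v (S w) - S (act v w)))"
        by (simp add: act_simps M.trace_linear)
      also have "\<dots> = - cnj a * trace_form u v"
        unfolding comm[OF a] trace_form_def act_simps by (rule M.trace_linear)
      also have "\<dots> = 0"
        by (simp add: K u)
      finally show ?case
        using step by (simp add: bracket_simps act_simps M.trace_linear)
    qed
  qed
  have "M.trace (\<lambda>w. act x (S w)) = 0"
    using x
  proof (induction rule: span_induct_alt)
    case base
    show ?case by (simp add: act_simps M.trace_linear)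
  next
    case (step c y y')
    then obtain u v where "y = bracket u v" "u \<in> K" by blast
    with step zero show ?case by (simp add: act_simps M.trace_linear)
  qed
  with tr show ?thesis
    by (intro M.nilpotent_if_trace_conjugate_eq_0[OF B(2) _ d endo_act])
      (simp_all add: M.finiteI_independent B)
qed

text \<open>The trace argument gives nilpotent action only for sums of brackets, so Engel's theorem
  is applied to the derived algebra; its solvability passes to \<open>K\<close> by one more derived
  step.\<close>

theorem cartan_solvable:
  assumes faithful and K: "lie_ideal K" and tr: "\<And>u y. u \<in> K \<Longrightarrow> trace_form u y = 0"
  shows "solvable K"
proof -
  let ?D = "derived_series K 1"
  have "span {bracket x y | x y. x \<in> K \<and> y \<in> K} \<subseteq> K"
    using K by (intro span_minimal) (auto simp: lie_ideal_def)
  hence DK: "?D \<subseteq> K" by simp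
  have "\<exists>N. kill ?D N = UNIV"
  proof (rule engel[OF assms(1)])
    show "subspace ?D" by simp
    show "bracket x y \<in> ?D" if "x \<in> ?D" "y \<in> ?D" for x y
      using that DK by (auto intro!: span_base)
    show "M.gen_eigenspace (act x) 0 = UNIV" if "x \<in> ?D" for x
    proof (rule nilpotent_if_trace_form_eq_0[OF tr])
      show "x \<in> span {bracket u v | u v. u \<in> K}"
        using that span_mono[of "{bracket u v | u v. u \<in> K \<and> v \<in> K}" "{bracket u v | u v. u \<in> K}"]
        by auto
    qed
  qed
  hence "solvable ?D"
    using solvable_if_kill[OF assms(1)] by blast
  thus ?thesis
    unfolding solvable_def using derived_series_Suc by metis
qed

text \<open>By invariance the radical of the form is an ideal, and Cartan's criterion makes it
  solvable.\<close>

lemma trace_form_nondegenerate: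
  assumes faithful semisimple and x: "\<And>y. trace_form x y = 0"
  shows "x = 0"
proof -
  let ?K = "{x. \<forall>y. trace_form x y = 0}"
  have "trace_form (bracket y k) z = 0" if "k \<in> ?K" for y k z
  proof -
    have "trace_form (bracket y k) z = trace_form (- bracket k y) z"
      by (subst bracket_antisym) simp
    also have "\<dots> = - trace_form k (bracket y z)"
      using trace_form_simps(3)[of 0 "bracket k y" z] by (simp add: trace_form_simps trace_form_invariant)
    finally show ?thesis using that by simp
  qed
  hence K: "lie_ideal ?K"
    unfolding lie_ideal_def by (auto intro!: subspaceI simp: trace_form_simps)
  moreover have "solvable ?K"
    by (rule cartan_solvable[OF assms(1) K]) simp
  ultimately have "?K = {0}"
    using assms(2) unfolding semisimple_def by blast
  thus ?thesis using x by auto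
qed

end

section \<open>Prelie products on semisimple Lie algebras\<close>

context fd_lie_module
begin

lemma trace_form_eq_0_on_basis:
  assumes "faithful" "semisimple" and zero: "\<And>b. b \<in> BasisG \<Longrightarrow> trace_form b y = 0"
  shows "y = 0"
proof (rule trace_form_nondegenerate[OF assms(1,2)])
  fix x
  have "x \<in> span BasisG"
    by (simp add: span_Basis)
  hence "trace_form x y = 0"
    by (induction rule: span_induct_alt) (simp_all add: zero trace_form_simps)
  thus "trace_form y x = 0"
    by (simp add: trace_form_commute)
qed

section \<open>Dual bases and the invariant tensor\<close>

definition dual_basis :: "('g \<Rightarrow> 'g) \<Rightarrow> bool"
  where "dual_basis f \<longleftrightarrow>
    (\<forall>b\<in>BasisG. \<forall>c\<in>BasisG. trace_form b (f c) = (if b = c then 1 else 0))"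

text \<open>\<open>F y\<close> has the pairings of \<open>y\<close> with the basis as coordinates.
  Nondegeneracy makes \<open>F\<close> injective, hence bijective, and the dual basis is its inverse
  on \<open>BasisG\<close>.\<close>

lemma dual_basis_exists:
  assumes "faithful" "semisimple"
  shows "\<exists>f. dual_basis f"
proof -
  define F where "F y = (\<Sum>b\<in>BasisG. scale (trace_form b y) b)" for y
  have F: "endo F"
    by (rule endoI)
      (simp_all add: F_def trace_form_simps scale_left_distrib sum.distrib scale_sum_right)
  have rep: "representation BasisG (F y) b = trace_form b y" if "b \<in> BasisG" for b y
    unfolding F_def using that
    by (simp add: representation_sum_scale independent_Basis span_Basis representation_basis
        finite_Basis if_distrib[of "(*) _"] sum.delta' cong: if_cong)
  have "y = 0" if "F y = 0" for y
    using rep[of _ y] that trace_form_eq_0_on_basis[OF assms, of y]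
    by (simp add: representation_zero)
  hence "inj F"
    by (simp add: inj_def) (metis F endo_simps(4) eq_iff_diff_eq_0)
  hence "surj F"
    by (rule linear_inj_imp_surj[OF F])
  hence "F (inv F c) = c" for c
    by (rule surj_f_inv_f)
  hence "trace_form b (inv F c) = (if b = c then 1 else 0)" if "b \<in> BasisG" "c \<in> BasisG" for b c
    using rep[OF that(1), of "inv F c"] that(2) by (simp add: representation_basis independent_Basis)
  thus ?thesis
    unfolding dual_basis_def by blast
qed

context
  fixes f
  assumes ss: faithful semisimple
    and dual: "dual_basis f"
begin

lemma expand_basis: "(\<Sum>c\<in>BasisG. scale (trace_form x (f c)) c) = x"
proof -
  have "trace_form x (f c) = representation BasisG x c" if "c \<in> BasisG" for c
  proof -
    have "trace_form x (f c) = trace_form (f c) (\<Sum>b\<in>BasisG. scale (representation BasisG x b) b)"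
      by (simp add: sum_representation independent_Basis span_Basis trace_form_commute)
    also have "\<dots> = (\<Sum>b\<in>BasisG. representation BasisG x b * trace_form b (f c))"
      by (simp add: trace_form_sum trace_form_commute)
    also have "\<dots> = representation BasisG x c"
      using that by (simp add: dual[unfolded dual_basis_def] finite_Basis if_distrib cong: if_cong)
    finally show ?thesis .
  qed
  thus ?thesis
    by (simp add: sum_representation independent_Basis span_Basis)
qed

lemma expand_dual_basis: "(\<Sum>c\<in>BasisG. scale (trace_form c x) (f c)) = x"
proof -
  have "x - (\<Sum>c\<in>BasisG. scale (trace_form c x) (f c)) = 0"
    by (rule trace_form_eq_0_on_basis[OF ss])
      (simp add: trace_form_simps trace_form_sum dual[unfolded dual_basis_def] finite_Basis if_distrib cong: if_cong)
  thus ?thesis by simp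
qed

text \<open>The functional is the pairing with \<open>z\<close>. Vanishing on brackets then says, by
  invariance, that every \<open>bracket y z\<close> is orthogonal to everything, so \<open>z\<close>
  is central.\<close>

lemma functional_eq_0:
  assumes \<phi>: "Vector_Spaces.linear scale (*) \<phi>" and zero: "\<And>x y. \<phi> (bracket x y) = 0"
  shows "\<phi> x = 0"
proof -
  interpret \<phi>: Vector_Spaces.linear scale "(*)" \<phi> by (rule \<phi>)
  define z where "z = (\<Sum>c\<in>BasisG. scale (\<phi> c) (f c))"
  have \<phi>_eq: "\<phi> x = trace_form x z" for x
  proof -
    have "\<phi> x = \<phi> (\<Sum>c\<in>BasisG. scale (trace_form x (f c)) c)"
      by (simp add: expand_basis)
    thus ?thesis
      by (simp add: \<phi>.sum \<phi>.scale z_def trace_form_sum mult.commute)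
  qed
  have "bracket y z = 0" for y
    using trace_form_nondegenerate[OF ss, of "bracket y z"] zero
    by (metis \<phi>_eq trace_form_commute trace_form_invariant)
  hence "z = 0"
    by (rule center_trivial[OF ss(2)])
  thus ?thesis by (simp add: \<phi>_eq trace_form_simps)
qed

text \<open>This is the invariance of the tensor \<open>\<Sum>b. b \<otimes> f b\<close> behind the Casimir element.\<close>

lemma dual_basis_invariant:
  assumes h: "bilinear_map scale scale scaleM h"
  shows "(\<Sum>b\<in>BasisG. h (bracket x b) (f b) + h b (bracket x (f b))) = 0"
proof -
  interpret l: Vector_Spaces.linear scale scaleM "\<lambda>u. h u v" for v
    using h by (simp add: bilinear_map_def)
  interpret r: Vector_Spaces.linear scale scaleM "h u" for u
    using h by (simp add: bilinear_map_def)
  have "h (bracket x b) (f b) = (\<Sum>c\<in>BasisG. scaleM (trace_form (bracket x b) (f c)) (h c (f b)))" for b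
  proof -
    have "h (bracket x b) (f b) = h (\<Sum>c\<in>BasisG. scale (trace_form (bracket x b) (f c)) c) (f b)"
      by (simp add: expand_basis)
    thus ?thesis by (simp add: l.sum l.scale)
  qed
  moreover have "h b (bracket x (f b)) = (\<Sum>c\<in>BasisG. scaleM (trace_form c (bracket x (f b))) (h b (f c)))" for b
  proof -
    have "h b (bracket x (f b)) = h b (\<Sum>c\<in>BasisG. scale (trace_form c (bracket x (f b))) (f c))"
      by (simp add: expand_dual_basis)
    thus ?thesis by (simp add: r.sum r.scale)
  qed
  \<comment> \<open>\<open>bracket x\<close> is skew for the form, so after exchanging the summation
    indices the two double sums cancel term by term.\<close>
  moreover have skew: "trace_form b (bracket x (f c)) = - trace_form (bracket x b) (f c)" for b c
  proof -
    have "trace_form b (bracket x (f c)) = trace_form (bracket b x) (f c)"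
      by (simp add: trace_form_invariant)
    moreover have skew: "\<dots> = trace_form (0 - bracket x b) (f c)"
      by (subst bracket_antisym) simp
    finally show ?thesis by (simp only: trace_form_simps) simp
  qed
  ultimately have eq: "(\<Sum>b\<in>BasisG. h (bracket x b) (f b) + h b (bracket x (f b)))
      = (\<Sum>b\<in>BasisG. \<Sum>c\<in>BasisG. scaleM (trace_form (bracket x b) (f c)) (h c (f b)))
        + (\<Sum>b\<in>BasisG. \<Sum>c\<in>BasisG. scaleM (trace_form c (bracket x (f b))) (h b (f c)))"
    by (simp add: sum.distrib)
  have swap: "(\<Sum>b\<in>BasisG. \<Sum>c\<in>BasisG. scaleM (trace_form c (bracket x (f b))) (h b (f c)))
      = (\<Sum>b\<in>BasisG. \<Sum>c\<in>BasisG. scaleM (trace_form b (bracket x (f c))) (h c (f b)))"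
    by (rule sum.swap)
  show ?thesis
    unfolding eq swap by (simp add: skew sum_negf)
qed

end

end

section \<open>Comparing prelie products with very good modules\<close>

lemma prelie_semisimple_trivial:
  fixes scale :: "complex \<Rightarrow> 'g::ab_group_add \<Rightarrow> 'g"
  assumes "lie_algebra scale bracket" and "finite_dimensional_vector_space scale Basis"
    and semisimple: "lie_algebra.semisimple scale bracket"
    and "prelie_product scale star" and "induces_bracket star bracket"
  shows "x = (0 :: 'g)"
proof -
  interpret lie_algebra scale bracket by fact
  interpret finite_dimensional_vector_space scale Basis by fact
  have star: "bilinear_map scale scale scale star"
    and assoc: "star (star x y) z - star x (star y z) = star (star y x) z - star y (star x z)" for x y z
    using assms(4) unfolding prelie_product_def by blast+
  have bracket: "bracket x y = star x y - star y x" for x y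
    using assms(5) by (simp add: induces_bracket_def)
  interpret l: Vector_Spaces.linear scale scale "\<lambda>x. star x y" for y
    using star by (simp add: bilinear_map_def)
  \<comment> \<open>The prelie identity, rearranged, says that left multiplication is a
    representation of the algebra on itself.\<close>
  interpret fd_lie_module scale bracket scale star Basis Basis
  proof unfold_locales
    show "star (bracket x y) v = star x (star y v) - star y (star x v)" for x y v
      using assoc[of x y v] by (simp add: bracket l.diff algebra_simps)
  qed (rule star)
  have "lie_ideal {x. \<forall>v. star x v = 0}"
    unfolding lie_ideal_def by (auto intro!: subspaceI simp: act_simps act_bracket)
  \<comment> \<open>If left multiplication by \<open>x\<close> and by \<open>y\<close> vanishes, so
    do both terms of \<open>star x y - star y x\<close>.\<close>
  moreover have "solvable {x. \<forall>v. star x v = 0}"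
    by (rule abelian_solvable) (simp add: bracket)
  ultimately have "{x. \<forall>v. star x v = 0} = {0}"
    using semisimple unfolding semisimple_def by blast
  hence faithful
    unfolding faithful_def by auto
  then obtain f where f: "dual_basis f"
    using dual_basis_exists[OF _ semisimple] by blast
  define \<phi> where "\<phi> x = trace (\<lambda>y. star y x)" for x
  have \<phi>: "Vector_Spaces.linear scale (*) \<phi>"
    unfolding Vector_Spaces.linear_iff
    by (intro conjI vector_space_axioms)
      (simp_all add: \<phi>_def act_simps trace_linear vector_space_def algebra_simps)
  have "\<phi> (bracket x y) = 0" for x y
  proof -
    have "\<phi> x = trace (star x) - trace (bracket x)" for x
      unfolding \<phi>_def trace_linear(2)[symmetric] by (simp add: bracket)
    moreover have "trace (star (bracket x y)) = 0"
      using trace_commute[OF endo_act endo_act, of x y]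
      by (simp add: act_bracket[abs_def] trace_linear(2))
    moreover have "trace (bracket (bracket x y)) = 0"
    proof -
      have "bracket (bracket x y) = (\<lambda>z. bracket x (bracket y z) - bracket y (bracket x z))"
      proof
        fix z
        show "bracket (bracket x y) z = bracket x (bracket y z) - bracket y (bracket x z)"
          using jacobi[of x y z] bracket_antisym[of "bracket x y" z] bracket_antisym[of z x]
          by (simp add: bracket_simps algebra_simps)
      qed
      thus ?thesis
        using trace_commute[OF linear_bracket linear_bracket, of x y] by (simp add: trace_linear(2))
    qed
    ultimately show ?thesis by simp
  qed
  hence \<phi>_0: "\<phi> x = 0" for x
    by (rule functional_eq_0[OF \<open>faithful\<close> semisimple f \<phi>])
  define w where "w = (\<Sum>b\<in>Basis. star b (f b))"
  have "star x w = (\<Sum>b\<in>Basis. star b (star (f b) x))" for x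
  proof -
    \<comment> \<open>Move \<open>x\<close> past \<open>b\<close> by the representation property,
      then past \<open>f b\<close> by the definition of the bracket. The two corrections sum to zero
      by \<open>dual_basis_invariant\<close>.\<close>
    have "star x (star b (f b))
        = star b (star (f b) x) + (star (bracket x b) (f b) + star b (bracket x (f b)))" for b
      by (simp add: act_bracket) (simp add: bracket act_simps)
    thus ?thesis
      using dual_basis_invariant[OF \<open>faithful\<close> semisimple f star, of x]
      by (simp add: w_def endo_sum[OF endo_act] sum.distrib)
  qed
  hence "\<phi> w = (\<Sum>b\<in>Basis. trace_form b (f b))"
    by (simp add: \<phi>_def trace_sum trace_form_def)
  also have "\<dots> = of_nat (card Basis)"
    using f by (simp add: dual_basis_def)
  finally have "Basis = {}"
    using \<phi>_0 finite_Basis by simp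
  hence "(UNIV :: 'g set) = {0}"
    using span_Basis by simp
  thus ?thesis by blast
qed

text \<open>The map \<open>x\<close> to \<open>act x m\<close> turns left multiplication into the
  action, so every identity is checked after applying this injective map. The prelie identity
  becomes \<open>act_bracket\<close> evaluated at \<open>act z m\<close>.\<close>

lemma prelie_of_very_good_pointed_module:
  assumes "very_good_pointed_module scale bracket scaleM act m"
  shows "\<exists>star. prelie_product scale star \<and> induces_bracket star bracket"
proof -
  interpret lie_module scale bracket scaleM act
    using assms by (simp add: very_good_pointed_module_def)
  have bij: "bij (\<lambda>x. act x m)"
    using assms by (simp add: very_good_pointed_module_def)
  interpret l: Vector_Spaces.linear scale scaleM "\<lambda>x. act x v" for v
    using act_bilinear by (simp add: bilinear_map_def)
  interpret r: Vector_Spaces.linear scaleM scaleM "act x" for x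
    using act_bilinear by (simp add: bilinear_map_def)
  define star where "star x y = inv (\<lambda>x. act x m) (act x (act y m))" for x y
  have star: "act (star x y) m = act x (act y m)" for x y
    unfolding star_def using surj_f_inv_f[OF bij_is_surj[OF bij]] .
  have eqI: "x = y" if "act x m = act y m" for x y
    using that bij by (auto dest: bij_is_inj injD)
  have "bracket x y = star x y - star y x" for x y
    by (rule eqI) (simp add: l.diff star act_bracket)
  moreover have "bilinear_map scale scale scale star"
    unfolding bilinear_map_def Vector_Spaces.linear_iff
    by (intro allI conjI vector_space_axioms; rule eqI)
      (simp_all add: star l.add l.scale r.add r.scale)
  moreover have "star (star x y) z - star x (star y z) = star (star y x) z - star y (star x z)" for x y z
  proof (rule eqI)
    have "act (star x y) v - act (star y x) v = act x (act y v) - act y (act x v)" for v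
      using \<open>\<And>x y. bracket x y = star x y - star y x\<close>[of x y] act_bracket[of x y v]
      by (simp add: l.diff)
    from this[of "act z m"]
    show "act (star (star x y) z - star x (star y z)) m = act (star (star y x) z - star y (star x z)) m"
      by (simp add: l.diff star algebra_simps)
  qed
  ultimately show ?thesis
    unfolding prelie_product_def induces_bracket_def by blast
qed

(* HOL cannot quantify existentially over types. A very good module is linearly isomorphic to
   the Lie algebra, so the existential ranges over modules on the type 'g; the second conjunct
   says that a very good pointed module on any other type 'm yields a prelie product as well. *)
theorem proposition17:
  fixes scale :: "complex \<Rightarrow> 'g::ab_group_add \<Rightarrow> 'g"
    and bracket :: "'g \<Rightarrow> 'g \<Rightarrow> 'g"
    and Basis :: "'g set"
  assumes "lie_algebra scale bracket"
    and "finite_dimensional_vector_space scale Basis"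
    and "lie_algebra.semisimple scale bracket"
  shows "((\<exists>star. prelie_product scale star \<and> induces_bracket star bracket) \<longleftrightarrow>
          (\<exists>(scaleM :: complex \<Rightarrow> 'g \<Rightarrow> 'g) act m.
             very_good_pointed_module scale bracket scaleM act m)) \<and>
         ((\<exists>(scaleM :: complex \<Rightarrow> 'm::ab_group_add \<Rightarrow> 'm) act m.
             very_good_pointed_module scale bracket scaleM act m) \<longrightarrow>
          (\<exists>star. prelie_product scale star \<and> induces_bracket star bracket))"
proof (intro conjI iffI impI)
  assume "\<exists>star. prelie_product scale star \<and> induces_bracket star bracket"
  then obtain star where star: "prelie_product scale star" "induces_bracket star bracket"
    by blast
  have zero: "x = 0" for x :: 'g
    using prelie_semisimple_trivial[OF assms star] .
  interpret lie_algebra scale bracket by fact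
  \<comment> \<open>The algebra is zero, so its adjoint module pointed at 0 is very good: a map
    between one-element spaces is bijective.\<close>
  have "lie_module scale bracket scale bracket"
  proof unfold_locales
    show "bracket (bracket x y) v = bracket x (bracket y v) - bracket y (bracket x v)" for x y v
      by (subst (1 2) zero) simp
  qed (rule bracket_bilinear)
  moreover have "bij (\<lambda>x. bracket x 0)"
    by (rule bijI') (use zero in metis)+
  ultimately show "\<exists>(scaleM :: complex \<Rightarrow> 'g \<Rightarrow> 'g) act m.
      very_good_pointed_module scale bracket scaleM act m"
    unfolding very_good_pointed_module_def by blast
qed (auto intro: prelie_of_very_good_pointed_module)

end
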